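(* Let $m\ge 2$ be an integer, let $a_1,\ldots,a_{m-1}$ be positive integers (not necessarily distinct), and let $S=\sum_{i=1}^{m-1}a_i$. Let $c=\lambda(S-1)-\mu$, where $\lambda,\mu$ are integers with $3\le\lambda\le S$ and $0\le\mu\le S-\lambda$ (equivalently, $c$ is an integer with $c\in\bigcup_{3\le\lambda\le S}[(\lambda-1)S,\lambda S-\lambda]$), and suppose $cS$ is even. For an integer $r\ge 2$ write $\mathrm{Rad}_r(c)$ for $\mathrm{Rad}_r(a_1,\ldots,a_{m-1},-1;c)$. (i) $\mathrm{Rad}_2(c)\ge\lambda+\mu$. (ii) If $\mu=0$, so that $c=\lambda(S-1)$, then for every integer $r>1$, $\mathrm{Rad}_r(\lambda(S-1))=\lambda$. (iii) If $\mu=1$, so that $c=\lambda(S-1)-1$, and the multiset $\{a_1,\ldots,a_{m-1}\}$ is $2$-distributable, then $\mathrm{Rad}_2(\lambda(S-1)-1)=\lambda+1$. (iv) If the multiset $\{a_1,\ldots,a_{m-1}\}$ is $3$-distributable and $\mu\ne 0,1$, then $\mathrm{Rad}_2(c)=\lambda+\mu$.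
   Context: For nonzero integers $b_1,\ldots,b_m$, an integer $c$ and an integer $r\ge 2$, the Rado number $\mathrm{Rad}_r(b_1,\ldots,b_m;c)$ is the least positive integer $N$ such that for every colouring $\chi:\{1,\ldots,N\}\to\{1,\ldots,r\}$ there exist $x_1,\ldots,x_m\in\{1,\ldots,N\}$ (not necessarily distinct) with $\sum_{i=1}^m b_ix_i=c$ and $\chi(x_1)=\cdots=\chi(x_m)$. Thus $\mathrm{Rad}_r(a_1,\ldots,a_{m-1},-1;c)$ refers to the equation $\sum_{i=1}^{m-1}a_ix_i-x_m=c$. If no such $N$ exists, the Rado number does not exist and is regarded as $\infty$ in inequalities; an equality or an upper bound by a finite number includes the assertion that it exists. A multiset $\{a_1,\ldots,a_k\}$ of positive integers is $t$-distributable ($t$ a positive integer) if for every choice of nonnegative integers $\sigma_1,\ldots,\sigma_t$ with $\sum_{j=1}^t\sigma_j=\sum_{i=1}^k a_i$ there is a partition of the index set $\{1,\ldots,k\}$ into pairwise disjoint sets $S_1,\ldots,S_t$ (some possibly empty) such that $\sum_{i\in S_j}a_i=\sigma_j$ for every $j\in\{1,\ldots,t\}$. *)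

theory Defs
  imports Main "HOL-Library.Extended_Nat" "HOL-Library.FuncSet" "HOL-Library.Disjoint_Sets"
begin

definition mono_solution :: "int list \<Rightarrow> int \<Rightarrow> nat \<Rightarrow> (nat \<Rightarrow> nat) \<Rightarrow> (nat \<Rightarrow> nat) \<Rightarrow> bool" where
  "mono_solution bs c N \<chi> x \<longleftrightarrow>
     (\<forall>i<length bs. x i \<in> {1..N}) \<and>
     (\<Sum>i<length bs. bs ! i * int (x i)) = c \<and>
     (\<forall>i<length bs. \<forall>j<length bs. \<chi> (x i) = \<chi> (x j))"

definition rado_forced :: "nat \<Rightarrow> int list \<Rightarrow> int \<Rightarrow> nat \<Rightarrow> bool" where
  "rado_forced r bs c N \<longleftrightarrow>
     (\<forall>\<chi> \<in> {1..N} \<rightarrow> {1..r}. \<exists>x. mono_solution bs c N \<chi> x)"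

(* On enat, Inf of a nonempty set is its least element and Inf of the empty set is \<infinity>,
   so \<infinity> is the value exactly when no Rado number exists. *)
definition Rado :: "nat \<Rightarrow> int list \<Rightarrow> int \<Rightarrow> enat" where
  "Rado r bs c = Inf (enat ` {N. N \<ge> 1 \<and> rado_forced r bs c N})"

(* A multiset is given by a list enumerating it with multiplicity; S j are the sets of
   positions forming the partition, where empty blocks are allowed. *)
definition distributable :: "nat \<Rightarrow> nat list \<Rightarrow> bool" where
  "distributable t as \<longleftrightarrow>
     (\<forall>\<sigma> :: nat \<Rightarrow> nat. (\<Sum>j\<in>{1..t}. \<sigma> j) = sum_list as \<longrightarrow>
        (\<exists>S :: nat \<Rightarrow> nat set.
           (\<Union>j\<in>{1..t}. S j) = {..<length as} \<and>
           disjoint_family_on S {1..t} \<and>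
           (\<forall>j\<in>{1..t}. (\<Sum>i\<in>S j. as ! i) = \<sigma> j)))"

end

theory Submission
  imports Defs
begin

text \<open>
  Substituting \<open>x = lam + y\<close> turns the equation into \<open>y\<^sub>m = mu + (\<Sum>i. a\<^sub>i * y\<^sub>i)\<close>, and
  \<open>x \<in> {1..N}\<close> into \<open>1 - lam \<le> y \<le> N - lam\<close>. All arguments are made in the variable \<open>y\<close>.

  \<^emph>\<open>Lower bound.\<close> Colour by the sign of \<open>y\<close>. If all \<open>y\<^sub>i \<ge> 0\<close> then \<open>y\<^sub>m \<ge> mu\<close>; if all
  \<open>y\<^sub>i \<le> -1\<close> then \<open>y\<^sub>m \<le> mu - S \<le> -lam\<close>. Neither value is available as long as \<open>N < lam + mu\<close>.

  \<^emph>\<open>Upper bounds.\<close> If the coefficients are \<open>t\<close>-distributable, then the unknowns can take \<open>t\<close>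
  prescribed values with arbitrary weights of total \<open>S\<close> (lemma
  \<open>mono_solution_of_shifted_weights\<close>), so it suffices to find monochromatic weighted solutions.
  Write \<open>(u, v, \<dots>; z)\<close> for one in which the \<open>y\<^sub>i\<close> take the values \<open>u, v, \<dots>\<close> and \<open>y\<^sub>m = z\<close>.
  The solution \<open>(0; mu)\<close> settles \<open>mu = 0\<close>, and otherwise separates \<open>0\<close> from \<open>mu\<close>.

  For \<open>mu = 1\<close> the parity hypothesis makes \<open>S\<close> even; now \<open>-1\<close> can have neither the colour of
  \<open>0\<close>, by \<open>(0, -1; 0)\<close>, nor that of \<open>1\<close>, by \<open>(1, -1; 1)\<close> with equal weights.

  For \<open>mu \<ge> 2\<close> the value \<open>-2\<close> is used too, which \<open>lam \<ge> 3\<close> makes available. The solution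
  \<open>(0, -1; 0)\<close> with weight \<open>mu\<close> at \<open>-1\<close> forces \<open>-1\<close> to have the colour of \<open>mu\<close>. Three cases
  remain. If \<open>-2\<close> has this colour too, a suitable choice of weights gives \<open>(mu, -1, -2; mu)\<close>
  (lemma \<open>balanced_weights_exist\<close>). If \<open>-2\<close> has the colour of \<open>0\<close> and \<open>mu\<close> is even,
  \<open>(0, -2; 0)\<close> is available. If \<open>-2\<close> has the colour of \<open>0\<close> and \<open>mu\<close> is odd, then \<open>S\<close> is even,
  so that \<open>(1, -1; mu)\<close> with equal weights gives \<open>1\<close> the colour of \<open>0\<close>, and \<open>(0, 1, -2; 0)\<close>
  is monochromatic.
\<close>

section \<open>Monochromatic solutions with prescribed values\<close>

lemma mono_solution_snoc_minus_one:
  "mono_solution (map int as @ [-1]) c N \<chi> x \<longleftrightarrow>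
     (\<forall>i\<le>length as. x i \<in> {1..N}) \<and>
     (\<Sum>i<length as. int (as ! i) * int (x i)) = c + int (x (length as)) \<and>
     (\<forall>i\<le>length as. \<chi> (x i) = \<chi> (x (length as)))"
proof -
  have "(\<Sum>i<length (map int as @ [-1]). (map int as @ [-1]) ! i * int (x i))
      = (\<Sum>i<length as. int (as ! i) * int (x i)) - int (x (length as))"
    by (simp add: nth_append)
  moreover have "(\<forall>i\<le>length as. \<forall>j\<le>length as. \<chi> (x i) = \<chi> (x j))
      \<longleftrightarrow> (\<forall>i\<le>length as. \<chi> (x i) = \<chi> (x (length as)))"
    by (metis order_refl)
  ultimately show ?thesis
    unfolding mono_solution_def by (simp add: less_Suc_eq_le diff_eq_eq)
qed

lemma distributable_1: "distributable 1 as"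
  unfolding distributable_def
proof (intro allI impI)
  fix \<sigma> :: "nat \<Rightarrow> nat"
  assume "(\<Sum>j\<in>{1..1}. \<sigma> j) = sum_list as"
  then show "\<exists>S. (\<Union>j\<in>{1..1}. S j) = {..<length as} \<and> disjoint_family_on S {1..1} \<and>
      (\<forall>j\<in>{1..1}. (\<Sum>i\<in>S j. as ! i) = \<sigma> j)"
    by (intro exI[of _ "\<lambda>_. {..<length as}"])
       (simp add: disjoint_family_on_def sum_list_sum_nth atLeast0LessThan)
qed

lemma distributable_weighted_sum:
  fixes v :: "nat \<Rightarrow> int"
  assumes "distributable t as" and "(\<Sum>j\<in>{1..t}. \<sigma> j) = sum_list as"
  obtains g where "\<And>i. i < length as \<Longrightarrow> g i \<in> {1..t}"
    and "(\<Sum>i<length as. int (as ! i) * v (g i)) = (\<Sum>j\<in>{1..t}. int (\<sigma> j) * v j)"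
proof -
  from assms obtain B where cover: "(\<Union>j\<in>{1..t}. B j) = {..<length as}"
    and disj: "disjoint_family_on B {1..t}"
    and sums: "\<forall>j\<in>{1..t}. (\<Sum>i\<in>B j. as ! i) = \<sigma> j"
    unfolding distributable_def by meson
  define g where "g i = (SOME j. j \<in> {1..t} \<and> i \<in> B j)" for i
  have g: "g i \<in> {1..t} \<and> i \<in> B (g i)" if "i < length as" for i
  proof -
    have "i \<in> (\<Union>j\<in>{1..t}. B j)"
      using that by (simp only: cover lessThan_iff)
    then have "\<exists>j. j \<in> {1..t} \<and> i \<in> B j"
      by blast
    then show ?thesis
      unfolding g_def by (rule someI_ex)
  qed
  have g_eq: "g i = j" if "j \<in> {1..t}" "i \<in> B j" for i j
  proof (rule ccontr)
    have "i < length as"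
      using that cover by auto
    assume "g i \<noteq> j"
    then show False
      using disjoint_family_onD[OF disj, of "g i" j] g[OF \<open>i < length as\<close>] that by auto
  qed
  have "(\<Sum>i<length as. int (as ! i) * v (g i)) = (\<Sum>j\<in>{1..t}. \<Sum>i\<in>B j. int (as ! i) * v (g i))"
    unfolding cover[symmetric]
  proof (rule sum.UNION_disjoint)
    show "\<forall>j\<in>{1..t}. finite (B j)"
      using cover by (metis UN_upper finite_lessThan finite_subset)
    show "\<forall>i\<in>{1..t}. \<forall>j\<in>{1..t}. i \<noteq> j \<longrightarrow> B i \<inter> B j = {}"
      using disj unfolding disjoint_family_on_def by blast
  qed simp
  also have "\<dots> = (\<Sum>j\<in>{1..t}. int (\<sigma> j) * v j)"
  proof (rule sum.cong[OF refl])
    fix j assume j: "j \<in> {1..t}"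
    have "(\<Sum>i\<in>B j. int (as ! i) * v (g i)) = (\<Sum>i\<in>B j. int (as ! i) * v j)"
      using g_eq j by (intro sum.cong) auto
    also have "\<dots> = int (\<sigma> j) * v j"
      using sums j by (simp flip: sum_distrib_right of_nat_sum)
    finally show "(\<Sum>i\<in>B j. int (as ! i) * v (g i)) = int (\<sigma> j) * v j" .
  qed
  finally show thesis
    using that g by blast
qed

text \<open>
  A weighted solution in the shifted variable is realised by giving all positions of the \<open>j\<close>-th
  block of a partition the value \<open>lam + y j\<close>. The weights total \<open>S\<close>, so the shift by \<open>lam\<close>
  contributes exactly \<open>lam * (S - 1)\<close>.
\<close>
lemma mono_solution_of_shifted_weights:
  fixes lam mu :: int and y :: "nat \<Rightarrow> int"
  assumes "distributable t as" and total: "(\<Sum>j\<in>{1..t}. \<sigma> j) = sum_list as"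
    and y: "\<And>j. j \<in> {1..t} \<Longrightarrow> y j \<in> {1 - lam..mu} \<and> \<chi> (nat (lam + y j)) = \<chi> (nat (lam + z))"
    and z: "z \<in> {1 - lam..mu}" and eq: "z = mu + (\<Sum>j\<in>{1..t}. int (\<sigma> j) * y j)"
  shows "\<exists>x. mono_solution (map int as @ [-1])
               (lam * (int (sum_list as) - 1) - mu) (nat (lam + mu)) \<chi> x"
proof -
  obtain g where g: "\<And>i. i < length as \<Longrightarrow> g i \<in> {1..t}"
    and sum_g: "(\<Sum>i<length as. int (as ! i) * y (g i)) = (\<Sum>j\<in>{1..t}. int (\<sigma> j) * y j)"
    using distributable_weighted_sum[OF assms(1) total] by blast
  define x where "x i = nat (lam + (if i < length as then y (g i) else z))" for i
  have range: "x i \<in> {1..nat (lam + mu)} \<and> \<chi> (x i) = \<chi> (nat (lam + z))" for i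
    using g[of i] y[of "g i"] z by (auto simp: x_def)
  have "(\<Sum>i<length as. int (as ! i) * int (x i))
      = (\<Sum>i<length as. lam * int (as ! i) + int (as ! i) * y (g i))"
  proof (rule sum.cong[OF refl])
    fix i assume "i \<in> {..<length as}"
    then show "int (as ! i) * int (x i) = lam * int (as ! i) + int (as ! i) * y (g i)"
      using g[of i] y[of "g i"] by (simp add: x_def algebra_simps)
  qed
  also have "\<dots> = lam * int (sum_list as) + (z - mu)"
    using sum_g eq
    by (simp add: sum.distrib sum_list_sum_nth atLeast0LessThan flip: sum_distrib_left)
  also have "\<dots> = lam * (int (sum_list as) - 1) - mu + int (x (length as))"
    using z by (simp add: x_def algebra_simps)
  finally have "mono_solution (map int as @ [-1])
      (lam * (int (sum_list as) - 1) - mu) (nat (lam + mu)) \<chi> x"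
    using range by (simp add: mono_solution_snoc_minus_one)
  then show ?thesis
    by blast
qed

lemma mono_solution_of_two_values:
  fixes lam mu u v z p q :: int
  assumes "distributable 2 as" and "p \<ge> 0" "q \<ge> 0" "p + q = int (sum_list as)"
    and "{u, v, z} \<subseteq> {1 - lam..mu}"
    and "\<chi> (nat (lam + u)) = \<chi> (nat (lam + z))" "\<chi> (nat (lam + v)) = \<chi> (nat (lam + z))"
    and "z = mu + p * u + q * v"
  shows "\<exists>x. mono_solution (map int as @ [-1])
               (lam * (int (sum_list as) - 1) - mu) (nat (lam + mu)) \<chi> x"
proof -
  have two: "{1..2::nat} = {1, 2}"
    by auto
  let ?\<sigma> = "\<lambda>j::nat. nat (if j = 1 then p else q)"
  let ?y = "\<lambda>j::nat. if j = 1 then u else v"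
  show ?thesis
  proof (rule mono_solution_of_shifted_weights[where \<sigma> = ?\<sigma> and y = ?y])
    show "(\<Sum>j\<in>{1..2}. ?\<sigma> j) = sum_list as"
      unfolding two using assms(2-4) by simp
    show "z = mu + (\<Sum>j\<in>{1..2}. int (?\<sigma> j) * ?y j)"
      unfolding two using assms by simp
    show "?y j \<in> {1 - lam..mu} \<and> \<chi> (nat (lam + ?y j)) = \<chi> (nat (lam + z))" for j
      using assms(5-7) by simp
    show "z \<in> {1 - lam..mu}"
      using assms by simp
  qed (fact assms(1))
qed

lemma mono_solution_of_three_values:
  fixes lam mu u v w z p q r :: int
  assumes "distributable 3 as" and "p \<ge> 0" "q \<ge> 0" "r \<ge> 0" "p + q + r = int (sum_list as)"
    and "{u, v, w, z} \<subseteq> {1 - lam..mu}"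
    and "\<chi> (nat (lam + u)) = \<chi> (nat (lam + z))" "\<chi> (nat (lam + v)) = \<chi> (nat (lam + z))"
      "\<chi> (nat (lam + w)) = \<chi> (nat (lam + z))"
    and "z = mu + p * u + q * v + r * w"
  shows "\<exists>x. mono_solution (map int as @ [-1])
               (lam * (int (sum_list as) - 1) - mu) (nat (lam + mu)) \<chi> x"
proof -
  have three: "{1..3::nat} = {1, 2, 3}"
    by auto
  let ?\<sigma> = "\<lambda>j::nat. nat (if j = 1 then p else if j = 2 then q else r)"
  let ?y = "\<lambda>j::nat. if j = 1 then u else if j = 2 then v else w"
  show ?thesis
  proof (rule mono_solution_of_shifted_weights[where \<sigma> = ?\<sigma> and y = ?y])
    show "(\<Sum>j\<in>{1..3}. ?\<sigma> j) = sum_list as"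
      unfolding three using assms(2-5) by simp
    show "z = mu + (\<Sum>j\<in>{1..3}. int (?\<sigma> j) * ?y j)"
      unfolding three using assms by simp
    show "?y j \<in> {1 - lam..mu} \<and> \<chi> (nat (lam + ?y j)) = \<chi> (nat (lam + z))" for j
      using assms(6-9) by simp
    show "z \<in> {1 - lam..mu}"
      using assms by simp
  qed (fact assms(1))
qed

text \<open>
  The constant solution \<open>(0; mu)\<close>: a single value needs only the partition into one block.
\<close>
lemma mono_solution_of_zero:
  fixes lam mu :: int
  assumes "lam \<ge> 1" "mu \<ge> 0" and "\<chi> (nat lam) = \<chi> (nat (lam + mu))"
  shows "\<exists>x. mono_solution (map int as @ [-1])
               (lam * (int (sum_list as) - 1) - mu) (nat (lam + mu)) \<chi> x"
  by (rule mono_solution_of_shifted_weights[where t = 1 and z = mu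
        and \<sigma> = "\<lambda>_. sum_list as" and y = "\<lambda>_. 0"])
     (use assms distributable_1[of as] in auto)

section \<open>Bounds on Rado numbers\<close>

text \<open>
  The colour classes \<open>x < lam\<close> and \<open>x \<ge> lam\<close> are the signs of \<open>y = x - lam\<close>. A solution in the
  first class would give \<open>x\<^sub>m \<le> lam + mu - S \<le> 0\<close>, one in the second \<open>x\<^sub>m \<ge> lam + mu > N\<close>.
\<close>
lemma not_rado_forced_below:
  fixes lam mu :: int
  assumes "r > 1" and "lam + mu \<le> int (sum_list as)" and "int N < lam + mu"
  shows "\<not> rado_forced r (map int as @ [-1]) (lam * (int (sum_list as) - 1) - mu) N"
proof
  let ?S = "int (sum_list as)"
  define \<chi> :: "nat \<Rightarrow> nat" where "\<chi> n = (if int n < lam then 1 else 2)" for n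
  have S_sum: "?S = (\<Sum>i<length as. int (as ! i))"
    by (simp add: sum_list_sum_nth atLeast0LessThan)
  assume "rado_forced r (map int as @ [-1]) (lam * (?S - 1) - mu) N"
  moreover have "\<chi> \<in> {1..N} \<rightarrow> {1..r}"
    using \<open>r > 1\<close> by (auto simp: \<chi>_def)
  ultimately obtain x where
    "mono_solution (map int as @ [-1]) (lam * (?S - 1) - mu) N \<chi> x"
    unfolding rado_forced_def by blast
  then have range: "x (length as) \<in> {1..N}"
    and colour: "\<And>i. i < length as \<Longrightarrow> \<chi> (x i) = \<chi> (x (length as))"
    and eq: "(\<Sum>i<length as. int (as ! i) * int (x i)) = lam * (?S - 1) - mu + int (x (length as))"
    unfolding mono_solution_snoc_minus_one by (blast intro: less_imp_le)+
  show False
  proof (cases "int (x (length as)) < lam")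
    case True
    have "int (as ! i) * int (x i) \<le> int (as ! i) * (lam - 1)" if "i < length as" for i
      using colour[OF that] True by (intro mult_left_mono) (auto simp: \<chi>_def split: if_splits)
    then have "(\<Sum>i<length as. int (as ! i) * int (x i)) \<le> (\<Sum>i<length as. int (as ! i) * (lam - 1))"
      by (intro sum_mono) auto
    also have "\<dots> = ?S * (lam - 1)"
      by (simp add: S_sum sum_distrib_right)
    finally have "int (x (length as)) \<le> lam + mu - ?S"
      using eq by (simp add: algebra_simps)
    then show False
      using assms range by auto
  next
    case False
    have "int (as ! i) * lam \<le> int (as ! i) * int (x i)" if "i < length as" for i
      using colour[OF that] False by (intro mult_left_mono) (auto simp: \<chi>_def split: if_splits)
    then have "(\<Sum>i<length as. int (as ! i) * lam) \<le> (\<Sum>i<length as. int (as ! i) * int (x i))"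
      by (intro sum_mono) auto
    moreover have "(\<Sum>i<length as. int (as ! i) * lam) = ?S * lam"
      by (simp add: S_sum sum_distrib_right)
    ultimately have "lam + mu \<le> int (x (length as))"
      using eq by (simp add: algebra_simps)
    then show False
      using assms range by auto
  qed
qed

lemma Rado_ge:
  assumes "\<And>N. int N < n \<Longrightarrow> \<not> rado_forced r bs c N"
  shows "Rado r bs c \<ge> enat (nat n)"
  unfolding Rado_def
proof (rule Inf_greatest, clarify)
  fix N assume "rado_forced r bs c N"
  then have "n \<le> int N"
    using assms by (meson not_less)
  then show "enat (nat n) \<le> enat N"
    by simp
qed

lemma Rado_le: "N \<ge> 1 \<Longrightarrow> rado_forced r bs c N \<Longrightarrow> Rado r bs c \<le> enat N"
  unfolding Rado_def by (rule Inf_lower) auto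

text \<open>
  The number \<open>p = \<lceil>S / (mu + 1)\<rceil>\<close> is the least one with \<open>S - p \<le> p * mu\<close>; as it is at least
  \<open>2\<close>, rounding up cannot push \<open>p * mu\<close> beyond \<open>2 * (S - p)\<close>. A total of \<open>p * mu\<close> is then
  reached by \<open>S - p\<close> summands equal to \<open>1\<close> or \<open>2\<close>.
\<close>
lemma balanced_weights_exist:
  fixes S mu :: int
  assumes "mu \<ge> 0" and "S > mu + 1"
  obtains p q r where "p \<ge> 0" "q \<ge> 0" "r \<ge> 0" "p + q + r = S" "p * mu = q + 2 * r"
proof -
  define d k where "d = (S - 1) div (mu + 1)" and "k = (S - 1) mod (mu + 1)"
  define p e where "p = d + 1" and "e = mu - k"
  have "d \<ge> 1"
    using zdiv_mono1[of "mu + 1" "S - 1" "mu + 1"] assms by (simp add: d_def)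
  then have "p \<ge> 2"
    by (simp add: p_def)
  have e: "0 \<le> e" "e \<le> mu"
    using pos_mod_bound[of "mu + 1" "S - 1"] pos_mod_sign[of "mu + 1" "S - 1"] assms
    by (simp_all add: e_def k_def)
  have "S - 1 = d * (mu + 1) + k"
    unfolding d_def k_def by (rule div_mult_mod_eq[symmetric])
  then have S: "S = p * mu + p - e"
    by (simp add: p_def e_def algebra_simps)
  have "2 * mu \<le> p * mu"
    using \<open>p \<ge> 2\<close> assms by (intro mult_right_mono) auto
  then show thesis
    using S e \<open>p \<ge> 2\<close> that[of p "p * mu - 2 * e" e] by linarith
qed

section \<open>The Rado numbers\<close>

theorem theorem13:
  fixes m :: nat and as :: "nat list" and S lam mu c :: int
  assumes "m \<ge> 2"
    and "length as = m - 1"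
    and "\<forall>a \<in> set as. a > 0"
    and "S = int (sum_list as)"
    and "3 \<le> lam" and "lam \<le> S"
    and "0 \<le> mu" and "mu \<le> S - lam"
    and "c = lam * (S - 1) - mu"
    and "even (c * S)"
  shows "Rado 2 (map int as @ [-1]) c \<ge> enat (nat (lam + mu))
    \<and> (mu = 0 \<longrightarrow>
         (\<forall>r::nat. r > 1 \<longrightarrow> Rado r (map int as @ [-1]) (lam * (S - 1)) = enat (nat lam)))
    \<and> (mu = 1 \<and> distributable 2 as \<longrightarrow>
         Rado 2 (map int as @ [-1]) (lam * (S - 1) - 1) = enat (nat (lam + 1)))
    \<and> (distributable 3 as \<and> mu \<noteq> 0 \<and> mu \<noteq> 1 \<longrightarrow>
         Rado 2 (map int as @ [-1]) c = enat (nat (lam + mu)))"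
proof -
  let ?bs = "map int as @ [-1]" and ?N = "nat (lam + mu)"
  have c: "c = lam * (int (sum_list as) - 1) - mu"
    using assms by simp
  have lower: "Rado r ?bs c \<ge> enat ?N" if "r > 1" for r
    unfolding c using that assms by (intro Rado_ge not_rado_forced_below) auto
  have Rado_eqI: "Rado r ?bs c = enat ?N" if "r > 1"
    "\<And>\<chi>. \<chi> \<in> {1..?N} \<rightarrow> {1..r} \<Longrightarrow> \<exists>x. mono_solution ?bs c ?N \<chi> x" for r
  proof (rule antisym)
    show "Rado r ?bs c \<le> enat ?N"
      using assms that(2) by (intro Rado_le) (auto simp: rado_forced_def)
  qed (use lower that(1) in auto)
  have two_colours: "\<chi> (nat (lam + y)) = 1 \<or> \<chi> (nat (lam + y)) = 2"
    if "\<chi> \<in> {1..?N} \<rightarrow> {1..2}" "y \<in> {1 - lam..mu}" for \<chi> :: "nat \<Rightarrow> nat" and y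
  proof -
    have "nat (lam + y) \<in> {1..?N}"
      using that(2) by auto
    then have "\<chi> (nat (lam + y)) \<in> {1..2}"
      using that(1) by blast
    then show ?thesis
      by auto
  qed
  \<comment> \<open>Since \<open>S * (S - 1)\<close> is even, \<open>c * S\<close> and \<open>mu * S\<close> have the same parity.\<close>
  have parity: "even mu \<or> even S"
    using assms by auto

  have "Rado r ?bs (lam * (S - 1)) = enat (nat lam)" if "mu = 0" "r > 1" for r
  proof -
    have "Rado r ?bs c = enat ?N"
      using mono_solution_of_zero[of lam mu] assms that by (intro Rado_eqI) (auto simp: c)
    then show ?thesis
      using that assms by simp
  qed

  moreover have "Rado 2 ?bs (lam * (S - 1) - 1) = enat (nat (lam + 1))"
    if "mu = 1" "distributable 2 as"
  proof -
    have "\<exists>x. mono_solution ?bs c ?N \<chi> x" if \<chi>: "\<chi> \<in> {1..?N} \<rightarrow> {1..2}" for \<chi>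
    proof (rule ccontr)
      assume none: "\<not> ?thesis"
      define col where "col y = \<chi> (nat (lam + y))" for y
      have no_two: False if "{u, v, z} \<subseteq> {1 - lam..mu}" "p \<ge> 0" "q \<ge> 0" "p + q = S"
        "z = mu + p * u + q * v" "col u = col z" "col v = col z" for u v z p q
        using mono_solution_of_two_values[of as p q u v z lam mu \<chi>]
          that none \<open>distributable 2 as\<close> \<open>S = _\<close> by (simp add: c col_def)
      have "col 0 \<noteq> col 1"
        using no_two[of 0 0 1 S 0] assms \<open>mu = 1\<close> by auto
      moreover have "col (-1) \<noteq> col 0"
        using no_two[of 0 "-1" 0 "S - 1" 1] assms \<open>mu = 1\<close> by auto
      moreover have "col (-1) \<noteq> col 1"
        using no_two[of 1 "-1" 1 "S div 2" "S div 2"] parity assms \<open>mu = 1\<close> by auto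
      ultimately show False
        using two_colours[OF \<chi>, of 0] two_colours[OF \<chi>, of 1] two_colours[OF \<chi>, of "-1"]
          assms \<open>mu = 1\<close> by (auto simp: col_def)
    qed
    then have "Rado 2 ?bs c = enat ?N"
      by (intro Rado_eqI) auto
    then show ?thesis
      using that assms by simp
  qed

  moreover have "Rado 2 ?bs c = enat ?N"
    if "distributable 3 as" "mu \<noteq> 0" "mu \<noteq> 1"
  proof (rule Rado_eqI)
    fix \<chi> assume \<chi>: "\<chi> \<in> {1..?N} \<rightarrow> {1..2::nat}"
    have "mu \<ge> 2"
      using assms that by auto
    show "\<exists>x. mono_solution ?bs c ?N \<chi> x"
    proof (rule ccontr)
      assume none: "\<not> ?thesis"
      define col where "col y = \<chi> (nat (lam + y))" for y
      have no_three: False if "{u, v, w, z} \<subseteq> {1 - lam..mu}" "p \<ge> 0" "q \<ge> 0" "r \<ge> 0"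
        "p + q + r = S" "z = mu + p * u + q * v + r * w"
        "col u = col z" "col v = col z" "col w = col z" for u v w z p q r
        using mono_solution_of_three_values[of as p q r u v w z lam mu \<chi>]
          that none \<open>distributable 3 as\<close> \<open>S = _\<close> by (simp add: c col_def)
      have one_of: "col y = col 0 \<or> col y = col mu" if "y \<in> {1 - lam..mu}" for y
      proof -
        have "col 0 \<noteq> col mu"
          using no_three[of 0 0 0 mu S 0 0] assms by auto
        then show ?thesis
          using two_colours[OF \<chi>, of y] two_colours[OF \<chi>, of 0] two_colours[OF \<chi>, of mu]
            assms that by (auto simp: col_def)
      qed
      have minus_one: "col (-1) = col mu"
        using one_of[of "-1"] no_three[of 0 "-1" 0 0 "S - mu" mu 0] assms by auto
      show False
      proof (cases "col (-2) = col mu")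
        case True
        obtain p q r where "p \<ge> 0" "q \<ge> 0" "r \<ge> 0" "p + q + r = S" "p * mu = q + 2 * r"
          using balanced_weights_exist[of mu S] assms by auto
        then show False
          using no_three[of mu "-1" "-2" mu p q r] True minus_one assms by auto
      next
        case False
        then have minus_two: "col (-2) = col 0"
          using one_of[of "-2"] assms by auto
        show False
        proof (cases "even mu")
          case True
          then obtain k where "mu = 2 * k" ..
          then show False
            using no_three[of 0 "-2" 0 0 "S - k" k 0] minus_two assms by auto
        next
          case False
          then obtain k where k: "mu = 2 * k + 1"
            by (rule oddE)
          from parity False obtain h where h: "S = 2 * h"
            by blast
          have bounds: "k \<ge> 1" "lam \<ge> 3" "2 * k + 4 \<le> S"
            using k \<open>mu \<ge> 2\<close> \<open>3 \<le> lam\<close> \<open>mu \<le> S - lam\<close> by linarith+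
          have "col 1 \<noteq> col mu"
            using no_three[of 1 "-1" 1 mu h h 0] minus_one h k bounds by auto
          then have "col 1 = col 0"
            using one_of[of 1] k bounds by simp
          then show False
            by (intro no_three[of 0 1 "-2" 0 "S - k - 2" 1 "k + 1"])
               (use minus_two k bounds in simp_all)
        qed
      qed
    qed
  qed simp

  ultimately show ?thesis
    using lower[of 2] by auto
qed

end
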